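(* Let $\alpha\in\mathbb{R}$, let $Z$ be a real random variable with $Z\sim BASLG_2(\alpha)$, and let $k\ge 1$ be an integer. If $k$ is even, then $$E(Z^{k})=\frac{2}{C_2(\alpha)}\Big[4\Big(1-\frac{1}{2^{k-1}}\Big)\Gamma(k+1)\zeta(k)+8\alpha^2\Big(1-\frac{1}{2^{k+1}}\Big)\Gamma(k+3)\zeta(k+2)+\alpha^4\Big(1-\frac{1}{2^{k+3}}\Big)\Gamma(k+5)\zeta(k+4)\Big],$$ and if $k$ is odd, then $$E(Z^{k})=\frac{2}{C_2(\alpha)}\Big[-8\alpha\Big(1-\frac{1}{2^{k}}\Big)\Gamma(k+2)\zeta(k+1)-4\alpha^3\Big(1-\frac{1}{2^{k+2}}\Big)\Gamma(k+4)\zeta(k+3)\Big].$$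
   Context: For $\alpha\in\mathbb{R}$, $BASLG_2(\alpha)$ (the Balakrishnan alpha skew logistic distribution with skewness parameter $\alpha$) is the continuous distribution on $\mathbb{R}$ with probability density function $$f_Z(z;\alpha)=\frac{[(1-\alpha z)^2+1]^2}{C_2(\alpha)}\,\frac{e^{-z}}{(1+e^{-z})^2},\quad z\in\mathbb{R},\qquad C_2(\alpha)=4+\frac{8\pi^2\alpha^2}{3}+\frac{7\pi^4\alpha^4}{15}.$$ Here $\zeta(s)=\sum_{j=1}^{\infty}j^{-s}$ is the Riemann zeta function and $\Gamma(s)=\int_0^\infty t^{s-1}e^{-t}\,dt$ is the Gamma function. *)

theory Defs
  imports "HOL-Probability.Probability"
begin

(* Only meaningful for s > 1: for other s the series diverges and its value is unspecified. *)
definition zeta :: "real \<Rightarrow> real" where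
  "zeta s = (\<Sum>j. 1 / real (j + 1) powr s)"

definition C2 :: "real \<Rightarrow> real" where
  "C2 \<alpha> = 4 + 8 * pi ^ 2 * \<alpha> ^ 2 / 3 + 7 * pi ^ 4 * \<alpha> ^ 4 / 15"

definition baslg2_density :: "real \<Rightarrow> real \<Rightarrow> real" where
  "baslg2_density \<alpha> z =
     ((1 - \<alpha> * z) ^ 2 + 1) ^ 2 / C2 \<alpha> * (exp (- z) / (1 + exp (- z)) ^ 2)"

end

theory Submission
  imports Defs
begin

text \<open>
  Up to the factor \<^term>\<open>C2 \<alpha>\<close>, the density is the polynomial
  \<open>((1 - \<alpha> z)\<^sup>2 + 1)\<^sup>2 = 4 - 8 \<alpha> z + 8 \<alpha>\<^sup>2 z\<^sup>2 - 4 \<alpha>\<^sup>3 z\<^sup>3 + \<alpha>\<^sup>4 z\<^sup>4\<close>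
  times the standard logistic density, so the \<open>k\<close>-th moment is a combination of the logistic
  moments of orders \<open>k, \<dots>, k + 4\<close>. The logistic density is symmetric: moments of odd order
  vanish, which is why the parity of \<open>k\<close> selects either the even or the odd powers of \<open>\<alpha>\<close>, and a
  moment of even order is twice the integral over the positive half-line.

  On the half-line, expand the density in powers of \<open>exp (- z)\<close>
  (\<open>logistic_density_sums\<close>). Integrated against \<open>z ^ m\<close>, the term with \<open>exp (- n z)\<close> is
  a Gamma integral with value \<open>\<plusminus> m! / n ^ m\<close>. The sum over \<open>n\<close> converges absolutely for \<open>m \<ge> 2\<close>,
  so summation and integration may be exchanged (\<open>logistic_half_moment\<close>), and what remains is
  the alternating zeta series, which equals \<open>(1 - 2 ^ (1 - m)) \<zeta>(m)\<close>
  (\<open>alternating_zeta_sums\<close>). The order \<open>m = 1\<close>, where absolute convergence fails, enters only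
  as a vanishing odd moment; integrability for every order comes from domination by an Erlang
  density instead of from the series.
\<close>

section \<open>The alternating zeta series\<close>

lemma zeta_nat_sums:
  fixes m :: nat
  assumes "m \<ge> 2"
  shows "(\<lambda>n. 1 / real (Suc n) ^ m) sums zeta (real m)"
proof -
  have "summable (\<lambda>n. 1 / real (Suc n) ^ m)"
    using inverse_power_summable[OF assms, where ?'a = real]
    by (subst (asm) summable_Suc_iff[symmetric]) (simp add: inverse_eq_divide)
  then show ?thesis
    by (simp add: zeta_def powr_realpow summable_sums del: of_nat_Suc)
qed

text \<open>
  Passing from the zeta series to the alternating one changes the sign of the terms with even
  denominator, that is, subtracts \<open>2 \<Sum>\<^sub>j (2 j) ^ (- m) = 2 ^ (1 - m) \<zeta>(m)\<close>.
\<close>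
lemma alternating_zeta_sums:
  fixes m :: nat
  assumes "m \<ge> 2"
  shows "(\<lambda>n. (-1) ^ n / real (Suc n) ^ m) sums ((1 - 1 / 2 ^ (m - 1)) * zeta (real m))"
proof -
  let ?g = "\<lambda>j. 2 / 2 ^ m * (1 / real (Suc j) ^ m)"
  have pow: "(2::real) ^ m = 2 * 2 ^ (m - 1)"
    using assms by (simp flip: power_Suc)
  have "(\<lambda>n. 1 / real (Suc n) ^ m - (if even n then 0 else ?g ((n - 1) div 2)))
          sums (zeta (real m) - 2 / 2 ^ m * zeta (real m))"
    using assms by (intro sums_diff zeta_nat_sums sums_if' sums_mult)
  moreover have "1 / real (Suc n) ^ m - (if even n then 0 else ?g ((n - 1) div 2))
                   = (-1) ^ n / real (Suc n) ^ m" for n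
  proof (cases "even n")
    case False
    then obtain j where n: "n = 2 * j + 1"
      by (auto elim: oddE)
    have "real (Suc n) = 2 * real (Suc j)"
      by (simp add: n)
    then have "real (Suc n) ^ m = 2 ^ m * real (Suc j) ^ m"
      by (simp only: power_mult_distrib)
    then show ?thesis
      using False by (simp add: n del: of_nat_Suc)
  qed simp
  ultimately show ?thesis
    by (simp add: pow algebra_simps del: of_nat_Suc)
qed

section \<open>Moments of the standard logistic density\<close>

definition logistic_density :: "real \<Rightarrow> real" where
  "logistic_density z = exp (- z) / (1 + exp (- z)) ^ 2"

lemma borel_measurable_logistic_density [measurable]:
  "logistic_density \<in> borel_measurable borel"
  unfolding logistic_density_def[abs_def] by measurable

lemma logistic_density_nonneg: "0 \<le> logistic_density z"
  by (simp add: logistic_density_def)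

lemma logistic_density_le_exp: "logistic_density z \<le> exp (- z)"
proof -
  have "1 \<le> (1 + exp (- z)) ^ 2"
    by (intro one_le_power) simp
  then show ?thesis
    by (simp add: logistic_density_def divide_le_eq add_pos_pos mult_le_cancel_left1)
qed

lemma logistic_density_uminus: "logistic_density (- z) = logistic_density z"
proof -
  have "exp z + 1 \<noteq> 0" "1 + exp z \<noteq> 0"
    using exp_gt_zero[of z] by linarith+
  then show ?thesis
    by (simp add: logistic_density_def exp_minus field_simps power2_eq_square)
qed

lemma exp_neg_Suc_mult: "exp (- real (Suc n) * z) = exp (- z) * exp (- z) ^ n" for z :: real
  using exp_of_nat_mult[of "Suc n" "- z"]
  by (simp only: mult_minus_left mult_minus_right power_Suc)

text \<open>This is the differentiated geometric series at \<open>- exp (- z)\<close>.\<close>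
lemma logistic_density_sums:
  assumes "z > 0"
  shows "(\<lambda>n. (-1) ^ n * (real (Suc n) * exp (- real (Suc n) * z))) sums logistic_density z"
proof -
  have "(\<lambda>n. exp (- z) * (real (Suc n) * (- exp (- z)) ^ n)) sums
          (exp (- z) * (1 / (1 - (- exp (- z))) ^ 2))"
    using assms by (intro sums_mult geometric_deriv_sums) simp
  moreover have "exp (- z) * (real (Suc n) * (- exp (- z)) ^ n)
      = (-1) ^ n * (real (Suc n) * exp (- real (Suc n) * z))" for n
    unfolding exp_neg_Suc_mult by (subst power_minus) simp
  ultimately show ?thesis
    by (simp only: logistic_density_def) simp
qed

lemma has_bochner_integral_erlang_density:
  assumes "0 < l"
  shows "has_bochner_integral lborel (erlang_density m l) 1"
  using nn_integral_erlang_ith_moment[OF assms, of m 0] assms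
  by (intro has_bochner_integral_nn_integral) auto

lemma integrable_logistic_half_moment:
  "integrable lborel (\<lambda>z. indicator {0..} z * (z ^ m * logistic_density z))"
proof (rule Bochner_Integration.integrable_bound)
  show "integrable lborel (\<lambda>z. fact m * erlang_density m 1 z)"
    using has_bochner_integral_erlang_density[of 1 m] by (auto simp: has_bochner_integral_iff)
  show "AE z in lborel. norm (indicator {0..} z * (z ^ m * logistic_density z))
          \<le> norm (fact m * erlang_density m 1 z)"
    using logistic_density_le_exp logistic_density_nonneg
    by (intro AE_I2)
       (auto simp: erlang_density_def abs_mult power_abs indicator_def intro!: mult_left_mono)
qed measurable

text \<open>
  After normalisation, the \<open>n\<close>-th term of the series is \<open>\<plusminus> m! / (n + 1) ^ m\<close> times the Erlang
  density of rate \<open>n + 1\<close>;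
  the \<open>L\<^sup>1\<close> norms of the terms are therefore summable exactly when \<open>m \<ge> 2\<close>.
\<close>
lemma logistic_half_moment:
  assumes "m \<ge> 2"
  shows "(\<integral>z. indicator {0..} z * (z ^ m * logistic_density z) \<partial>lborel)
           = (1 - 1 / 2 ^ (m - 1)) * Gamma (real m + 1) * zeta (real m)"
proof -
  define c where "c n = fact m * ((-1) ^ n / real (Suc n) ^ m)" for n
  define f where "f n z = c n * erlang_density m (real (Suc n)) z" for n z
  have f_eq: "f n z = indicator {0..} z *
      (z ^ m * ((-1) ^ n * (real (Suc n) * exp (- real (Suc n) * z))))" for n z
    by (simp add: f_def c_def erlang_density_def indicator_def del: of_nat_Suc)
  have abs_f: "\<bar>f n z\<bar> = \<bar>c n\<bar> * erlang_density m (real (Suc n)) z" for n z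
    by (simp add: f_def abs_mult)
  have int_f: "integrable lborel (f n)" "(\<integral>z. f n z \<partial>lborel) = c n"
    and int_abs_f: "(\<integral>z. \<bar>f n z\<bar> \<partial>lborel) = \<bar>c n\<bar>" for n
    using has_bochner_integral_erlang_density[of "real (Suc n)" m]
    unfolding abs_f by (auto simp: f_def[abs_def] has_bochner_integral_iff)
  have abs_c: "\<bar>c n\<bar> = fact m * (1 / real (Suc n) ^ m)" for n
    by (simp add: c_def abs_mult power_abs)
  have f_sums: "(\<lambda>n. f n z) sums (indicator {0..} z * (z ^ m * logistic_density z))" for z
  proof (cases "z > 0")
    case True
    then show ?thesis
      unfolding f_eq by (intro sums_mult logistic_density_sums)
  next
    case False
    \<comment> \<open>At \<open>z = 0\<close> the logistic series diverges, but the factor \<open>z ^ m\<close> annihilates it.\<close>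
    then show ?thesis
      using assms by (cases "z = 0") (auto simp: f_eq power_0_left)
  qed
  have f_abs_summable: "summable (\<lambda>n. \<bar>f n z\<bar>)" for z
  proof (cases "z > 0")
    case True
    have "(\<lambda>n. exp (- z) * (real (Suc n) * exp (- z) ^ n)) sums
            (exp (- z) * (1 / (1 - exp (- z)) ^ 2))"
      using True by (intro sums_mult geometric_deriv_sums) simp
    then have "summable (\<lambda>n. z ^ m * (exp (- z) * (real (Suc n) * exp (- z) ^ n)))"
      by (rule summable_mult[OF sums_summable])
    moreover have "\<bar>f n z\<bar> = z ^ m * (exp (- z) * (real (Suc n) * exp (- z) ^ n))" for n
      unfolding f_eq exp_neg_Suc_mult using True by (simp add: abs_mult power_abs)
    ultimately show ?thesis
      by simp
  next
    case False
    then show ?thesis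
      using assms by (cases "z = 0") (auto simp: f_eq power_0_left)
  qed
  have "(\<integral>z. indicator {0..} z * (z ^ m * logistic_density z) \<partial>lborel)
          = (\<integral>z. (\<Sum>n. f n z) \<partial>lborel)"
    using f_sums by (simp add: sums_iff)
  also have "\<dots> = (\<Sum>n. \<integral>z. f n z \<partial>lborel)"
  proof (rule integral_suminf)
    show "summable (\<lambda>n. \<integral>z. norm (f n z) \<partial>lborel)"
      unfolding real_norm_def int_abs_f abs_c
      by (rule summable_mult[OF sums_summable[OF zeta_nat_sums[OF assms]]])
  qed (use int_f f_abs_summable in auto)
  also have "\<dots> = fact m * ((1 - 1 / 2 ^ (m - 1)) * zeta (real m))"
    using sums_mult[OF alternating_zeta_sums[OF assms], of "fact m"]
    by (simp add: int_f c_def sums_iff)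
  finally show ?thesis
    using Gamma_fact[of m, where ?'a = real] by (simp add: add.commute)
qed

text \<open>
  Split the line at the origin and reflect the negative half. The two closed half-lines overlap
  at \<open>0\<close>, which is harmless as \<open>z ^ m\<close> vanishes there for \<open>m \<ge> 1\<close>.
\<close>
lemma has_bochner_integral_logistic_moment:
  assumes "m \<ge> 1"
  shows "has_bochner_integral lborel (\<lambda>z. z ^ m * logistic_density z)
           (if even m then 2 * (1 - 1 / 2 ^ (m - 1)) * Gamma (real m + 1) * zeta (real m) else 0)"
proof -
  define g where "g z = indicator {0..} z * (z ^ m * logistic_density z)" for z
  have int: "has_bochner_integral lborel g (integral\<^sup>L lborel g)"
    unfolding g_def by (intro has_bochner_integral_integrable integrable_logistic_half_moment)
  then have "has_bochner_integral lborel (\<lambda>z. g (- z)) (integral\<^sup>L lborel g)"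
    using lborel_has_bochner_integral_real_affine_iff[of "-1" g "integral\<^sup>L lborel g" 0] by simp
  then have "has_bochner_integral lborel (\<lambda>z. g z + (-1) ^ m * g (- z))
               (integral\<^sup>L lborel g + (-1) ^ m * integral\<^sup>L lborel g)"
    using int by (intro has_bochner_integral_add has_bochner_integral_mult_right) auto
  moreover have "g z + (-1) ^ m * g (- z) = z ^ m * logistic_density z" for z
  proof -
    have "(-1) ^ m * (- z) ^ m = z ^ m"
      by (simp flip: power_mult_distrib)
    then show ?thesis
      using assms
      by (cases z "0::real" rule: linorder_cases)
         (auto simp: g_def logistic_density_uminus simp flip: mult.assoc)
  qed
  moreover have "integral\<^sup>L lborel g + (-1) ^ m * integral\<^sup>L lborel g
      = (if even m then 2 * (1 - 1 / 2 ^ (m - 1)) * Gamma (real m + 1) * zeta (real m) else 0)"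
  proof (cases "even m")
    case True
    then have "m \<ge> 2"
      using assms by (auto elim!: evenE)
    then show ?thesis
      using True logistic_half_moment[of m] by (simp add: g_def[abs_def])
  qed simp
  ultimately show ?thesis
    by simp
qed

section \<open>Moments of the skew density\<close>

lemma baslg2_density_nonneg: "0 \<le> baslg2_density \<alpha> z"
  by (auto simp: baslg2_density_def C2_def
      intro!: mult_nonneg_nonneg divide_nonneg_nonneg add_nonneg_nonneg)

lemma baslg2_density_moment_expand:
  "baslg2_density \<alpha> z * z ^ k = 1 / C2 \<alpha> *
     (4 * (z ^ k * logistic_density z)
      - 8 * \<alpha> * (z ^ (k + 1) * logistic_density z)
      + 8 * \<alpha> ^ 2 * (z ^ (k + 2) * logistic_density z)
      - 4 * \<alpha> ^ 3 * (z ^ (k + 3) * logistic_density z)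
      + \<alpha> ^ 4 * (z ^ (k + 4) * logistic_density z))"
proof -
  have "((1 - \<alpha> * z) ^ 2 + 1) ^ 2
          = 4 - 8 * \<alpha> * z + 8 * \<alpha> ^ 2 * z ^ 2 - 4 * \<alpha> ^ 3 * z ^ 3 + \<alpha> ^ 4 * z ^ 4"
    by algebra
  then have "baslg2_density \<alpha> z * z ^ k = 1 / C2 \<alpha> *
     ((4 - 8 * \<alpha> * z + 8 * \<alpha> ^ 2 * z ^ 2 - 4 * \<alpha> ^ 3 * z ^ 3 + \<alpha> ^ 4 * z ^ 4)
        * (z ^ k * logistic_density z))"
    by (simp add: baslg2_density_def logistic_density_def)
  also have "(4 - 8 * \<alpha> * z + 8 * \<alpha> ^ 2 * z ^ 2 - 4 * \<alpha> ^ 3 * z ^ 3 + \<alpha> ^ 4 * z ^ 4)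
        * (z ^ k * logistic_density z)
      = 4 * (z ^ k * logistic_density z)
      - 8 * \<alpha> * (z ^ (k + 1) * logistic_density z)
      + 8 * \<alpha> ^ 2 * (z ^ (k + 2) * logistic_density z)
      - 4 * \<alpha> ^ 3 * (z ^ (k + 3) * logistic_density z)
      + \<alpha> ^ 4 * (z ^ (k + 4) * logistic_density z)"
    unfolding power_add by algebra
  finally show ?thesis .
qed

theorem theorem4:
  fixes M :: "'a measure" and Z :: "'a \<Rightarrow> real" and \<alpha> :: real and k :: nat
  assumes "prob_space M"
    and "distributed M lborel Z (\<lambda>z. ennreal (baslg2_density \<alpha> z))"
    and "k \<ge> 1"
  shows "integrable M (\<lambda>\<omega>. Z \<omega> ^ k) \<and>
    (even k \<longrightarrow>
      prob_space.expectation M (\<lambda>\<omega>. Z \<omega> ^ k) =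
        2 / C2 \<alpha> *
          (4 * (1 - 1 / 2 ^ (k - 1)) * Gamma (real k + 1) * zeta (real k)
           + 8 * \<alpha> ^ 2 * (1 - 1 / 2 ^ (k + 1)) * Gamma (real k + 3) * zeta (real k + 2)
           + \<alpha> ^ 4 * (1 - 1 / 2 ^ (k + 3)) * Gamma (real k + 5) * zeta (real k + 4))) \<and>
    (odd k \<longrightarrow>
      prob_space.expectation M (\<lambda>\<omega>. Z \<omega> ^ k) =
        2 / C2 \<alpha> *
          (- 8 * \<alpha> * (1 - 1 / 2 ^ k) * Gamma (real k + 2) * zeta (real k + 1)
           - 4 * \<alpha> ^ 3 * (1 - 1 / 2 ^ (k + 2)) * Gamma (real k + 4) * zeta (real k + 3)))"
proof -
  define L where "L m = (if even m
    then 2 * (1 - 1 / 2 ^ (m - 1)) * Gamma (real m + 1) * zeta (real m) else 0)" for m :: nat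
  have L: "has_bochner_integral lborel (\<lambda>z. z ^ m * logistic_density z) (L m)" if "m \<ge> 1" for m
    unfolding L_def by (rule has_bochner_integral_logistic_moment[OF that])
  have int: "has_bochner_integral lborel (\<lambda>z. baslg2_density \<alpha> z * z ^ k)
    (1 / C2 \<alpha> * (4 * L k - 8 * \<alpha> * L (k + 1) + 8 * \<alpha> ^ 2 * L (k + 2)
                 - 4 * \<alpha> ^ 3 * L (k + 3) + \<alpha> ^ 4 * L (k + 4)))"
    unfolding baslg2_density_moment_expand using \<open>k \<ge> 1\<close>
    by (intro has_bochner_integral_mult_right has_bochner_integral_add has_bochner_integral_diff L)
       auto
  have integrable: "integrable M (\<lambda>\<omega>. Z \<omega> ^ k)"
    using int distributed_integrable[OF assms(2), of "\<lambda>z. z ^ k"]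
    by (auto simp: baslg2_density_nonneg has_bochner_integral_iff)
  have "(\<integral>\<omega>. Z \<omega> ^ k \<partial>M) = (\<integral>z. baslg2_density \<alpha> z * z ^ k \<partial>lborel)"
    using distributed_integral[OF assms(2), of "\<lambda>z. z ^ k"] by (simp add: baslg2_density_nonneg)
  also have "\<dots> = 1 / C2 \<alpha> * (4 * L k - 8 * \<alpha> * L (k + 1) + 8 * \<alpha> ^ 2 * L (k + 2)
                 - 4 * \<alpha> ^ 3 * L (k + 3) + \<alpha> ^ 4 * L (k + 4))"
    using int by (simp add: has_bochner_integral_iff)
  finally have moment: "(\<integral>\<omega>. Z \<omega> ^ k \<partial>M) = \<dots>" .
  have even_combine: "1 / c * (4 * (2 * p) - 8 * \<alpha> * 0 + 8 * \<alpha> ^ 2 * (2 * q)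
                               - 4 * \<alpha> ^ 3 * 0 + \<alpha> ^ 4 * (2 * r))
                       = 2 / c * (4 * p + 8 * \<alpha> ^ 2 * q + \<alpha> ^ 4 * r)"
    and odd_combine: "1 / c * (4 * 0 - 8 * \<alpha> * (2 * p) + 8 * \<alpha> ^ 2 * 0
                               - 4 * \<alpha> ^ 3 * (2 * q) + \<alpha> ^ 4 * 0)
                       = 2 / c * (- 8 * \<alpha> * p - 4 * \<alpha> ^ 3 * q)" for c p q r
    by (simp_all add: algebra_simps add_divide_distrib)
  have even_case: "(\<integral>\<omega>. Z \<omega> ^ k \<partial>M) = 2 / C2 \<alpha> *
          (4 * (1 - 1 / 2 ^ (k - 1)) * Gamma (real k + 1) * zeta (real k)
           + 8 * \<alpha> ^ 2 * (1 - 1 / 2 ^ (k + 1)) * Gamma (real k + 3) * zeta (real k + 2)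
           + \<alpha> ^ 4 * (1 - 1 / 2 ^ (k + 3)) * Gamma (real k + 5) * zeta (real k + 4))"
    if "even k"
  proof -
    have "L k = 2 * ((1 - 1 / 2 ^ (k - 1)) * Gamma (real k + 1) * zeta (real k))"
      "L (k + 2) = 2 * ((1 - 1 / 2 ^ (k + 1)) * Gamma (real k + 3) * zeta (real k + 2))"
      "L (k + 4) = 2 * ((1 - 1 / 2 ^ (k + 3)) * Gamma (real k + 5) * zeta (real k + 4))"
      "L (k + 1) = 0" "L (k + 3) = 0"
      using that by (simp_all add: L_def add.commute)
    then show ?thesis
      unfolding moment by (simp only: even_combine) (simp only: mult.assoc)
  qed
  have odd_case: "(\<integral>\<omega>. Z \<omega> ^ k \<partial>M) = 2 / C2 \<alpha> *
          (- 8 * \<alpha> * (1 - 1 / 2 ^ k) * Gamma (real k + 2) * zeta (real k + 1)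
           - 4 * \<alpha> ^ 3 * (1 - 1 / 2 ^ (k + 2)) * Gamma (real k + 4) * zeta (real k + 3))"
    if "odd k"
  proof -
    have "L (k + 1) = 2 * ((1 - 1 / 2 ^ k) * Gamma (real k + 2) * zeta (real k + 1))"
      "L (k + 3) = 2 * ((1 - 1 / 2 ^ (k + 2)) * Gamma (real k + 4) * zeta (real k + 3))"
      "L k = 0" "L (k + 2) = 0" "L (k + 4) = 0"
      using that by (simp_all add: L_def add.commute)
    then show ?thesis
      unfolding moment by (simp only: odd_combine) (simp only: mult.assoc)
  qed
  show ?thesis
    using integrable even_case odd_case by blast
qed

end
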